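(* For every $p\in L^{\varphi^*}(\Omega;\mathbb R^N)$, $$\rho_\varphi^*(p)=\int_\Omega\Phi^*(x,p(x))\,dx=\int_\Omega\varphi^*(x,|p(x)|)\,dx$$ (as an identity in $[0,\infty]$). In particular, $\rho_\varphi^*(p)<\infty$ if and only if $p\in\operatorname{dom}\rho_{\varphi^*}$.
   Context: $\Omega\subset\mathbb R^N$ is a bounded Lipschitz domain with Lebesgue measure. $L^0(\Omega;\mathbb R^N)$ is the space of (a.e.-equivalence classes of) measurable vector fields. Standing assumptions on $\varphi:\Omega\times[0,\infty)\to[0,\infty)$: $x\mapsto\varphi(x,t)$ is measurable for every $t\ge0$; for a.e. $x\in\Omega$ the map $t\mapsto\varphi(x,t)$ is convex, increasing (in the non-strict sense), continuous, and $\varphi(x,0)=0$; $\varphi(\cdot,t)\in L^1(\Omega)$ for every $t\ge0$; there is a constant $C_\Delta$ with $\varphi(x,2t)\le C_\Delta\varphi(x,t)$ for a.e. $x\in\Omega$ and all $t\ge0$; and $\lim_{t\to\infty}\operatorname{ess\,inf}_{x\in\Omega}\varphi(x,t)/t=\infty$. Set $\Phi(x,z):=\varphi(x,|z|)$ for $z\in\mathbb R^N$, $\varphi^*(x,s):=\sup_{t\ge0}\{st-\varphi(x,t)\}$ for $s\ge0$, and $\Phi^*(x,\xi):=\sup_{z\in\mathbb R^N}\{\xi\cdot z-\Phi(x,z)\}$ for $\xi\in\mathbb R^N$. For $\psi\in\{\varphi,\varphi^*\}$ and $v\in L^0(\Omega;\mathbb R^N)$ set $\rho_\psi(v):=\int_\Omega\psi(x,|v(x)|)\,dx$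 and $L^\psi(\Omega;\mathbb R^N):=\{v\in L^0(\Omega;\mathbb R^N):\rho_\psi(\lambda v)<\infty\text{ for some }\lambda>0\}$. Define $\operatorname{dom}\rho_{\varphi^*}:=\{p\in L^{\varphi^*}(\Omega;\mathbb R^N):\rho_{\varphi^*}(p)<\infty\}$ and the Fenchel conjugate of the functional $\rho_\varphi$ by $$\rho_\varphi^*(p):=\sup_{v\in L^\varphi(\Omega;\mathbb R^N)}\Bigl\{\int_\Omega p\cdot v\,dx-\rho_\varphi(v)\Bigr\},\qquad p\in L^{\varphi^*}(\Omega;\mathbb R^N).$$ *)

theory Defs
  imports "HOL-Probability.Essential_Supremum"
begin

text \<open>Near every boundary point, the domain is the open region above the graph of a Lipschitz
  function of the coordinates orthogonal to some direction \<open>e\<close>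
  (\<open>y - (y \<bullet> e) *\<^sub>R e\<close> is the orthogonal projection of \<open>y\<close> onto
  the hyperplane \<open>{y. y \<bullet> e = 0}\<close>).\<close>

definition lipschitz_domain :: "(real ^ 'n) set \<Rightarrow> bool" where
  "lipschitz_domain \<Omega> \<longleftrightarrow> open \<Omega> \<and> connected \<Omega> \<and> \<Omega> \<noteq> {} \<and>
     (\<forall>a\<in>frontier \<Omega>. \<exists>e r L \<gamma>. norm e = 1 \<and> 0 < r \<and> L-lipschitz_on {y. y \<bullet> e = 0} \<gamma> \<and>
        \<Omega> \<inter> ball a r = {y \<in> ball a r. \<gamma> (y - (y \<bullet> e) *\<^sub>R e) < y \<bullet> e})"

definition essinf :: "'a measure \<Rightarrow> ('a \<Rightarrow> ereal) \<Rightarrow> ereal" where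
  "essinf M f = - esssup M (\<lambda>x. - f x)"

definition Phi_of :: "('a \<Rightarrow> real \<Rightarrow> real) \<Rightarrow> 'a \<Rightarrow> real ^ 'n \<Rightarrow> real" where
  "Phi_of \<phi> x z = \<phi> x (norm z)"

definition conj_half :: "('a \<Rightarrow> real \<Rightarrow> real) \<Rightarrow> 'a \<Rightarrow> real \<Rightarrow> ereal" where
  "conj_half \<phi> x s = (SUP t\<in>{0..}. ereal (s * t - \<phi> x t))"

definition conj_vec :: "('a \<Rightarrow> real ^ 'n \<Rightarrow> real) \<Rightarrow> 'a \<Rightarrow> real ^ 'n \<Rightarrow> ereal" where
  "conj_vec F x \<xi> = (SUP z. ereal (\<xi> \<bullet> z - F x z))"

text \<open>The truncation \<open>e2ennreal\<close> is harmless: \<open>\<psi>\<close> will be \<open>\<phi>\<close> or its conjugate, and both are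
  nonnegative for almost every \<open>x\<close>, the latter because \<open>\<phi> x 0 = 0\<close>.\<close>

definition modular :: "(real ^ 'n) set \<Rightarrow> (real ^ 'n \<Rightarrow> real \<Rightarrow> ereal) \<Rightarrow> (real ^ 'n \<Rightarrow> real ^ 'n) \<Rightarrow> ennreal" where
  "modular \<Omega> \<psi> v = (\<integral>\<^sup>+ x. e2ennreal (\<psi> x (norm (v x))) \<partial>lebesgue_on \<Omega>)"

text \<open>Almost-everywhere equivalence classes are represented by their members; the modulars and
  integrals below do not depend on the representative.\<close>

definition L_space :: "(real ^ 'n) set \<Rightarrow> (real ^ 'n \<Rightarrow> real \<Rightarrow> ereal) \<Rightarrow> (real ^ 'n \<Rightarrow> real ^ 'n) set" where
  "L_space \<Omega> \<psi> = {v \<in> borel_measurable (lebesgue_on \<Omega>).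
     \<exists>c::real. 0 < c \<and> modular \<Omega> \<psi> (\<lambda>x. c *\<^sub>R v x) < \<infinity>}"

definition dom_modular :: "(real ^ 'n) set \<Rightarrow> (real ^ 'n \<Rightarrow> real \<Rightarrow> ereal) \<Rightarrow> (real ^ 'n \<Rightarrow> real ^ 'n) set" where
  "dom_modular \<Omega> \<psi> = {p \<in> L_space \<Omega> \<psi>. modular \<Omega> \<psi> p < \<infinity>}"

text \<open>For \<open>p\<close> in the space of the conjugate of \<open>\<phi>\<close> the product \<open>p \<bullet> v\<close> is integrable by
  Young's inequality, so the Bochner integral does not take its default value \<open>0\<close> there.\<close>

definition conj_modular ::
  "(real ^ 'n) set \<Rightarrow> (real ^ 'n \<Rightarrow> real \<Rightarrow> real) \<Rightarrow> (real ^ 'n \<Rightarrow> real ^ 'n) \<Rightarrow> ereal" where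
  "conj_modular \<Omega> \<phi> p = (SUP v\<in>L_space \<Omega> (\<lambda>x t. ereal (\<phi> x t)).
     ereal (\<integral>x. p x \<bullet> v x \<partial>lebesgue_on \<Omega>) - enn2ereal (modular \<Omega> (\<lambda>x t. ereal (\<phi> x t)) v))"

end

theory Submission
  imports Defs
begin

text \<open>The upper bound is Young's inequality. For the lower bound, let \<open>t 0 = 0, t 1, \<dots>\<close> be dense in
  \<open>[0, \<infinity>)\<close>. By continuity, \<open>conj_half \<phi> x (norm (p x))\<close> is almost everywhere the
  increasing limit of the maxima \<open>G\<^sub>n x\<close> of \<open>norm (p x) * t k - \<phi> x (t k)\<close> over \<open>k \<le> n\<close>. A maximiser
  \<open>T\<^sub>n x\<close> among \<open>t 0, \<dots>, t n\<close> can be chosen measurably, and the bounded field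
  \<open>T\<^sub>n x *\<^sub>R sgn (p x)\<close> is an admissible competitor whose value is the integral of \<open>G\<^sub>n\<close>. Monotone
  convergence concludes.\<close>

section \<open>Measurable selection of a maximiser\<close>

primrec argmax_upto :: "(nat \<Rightarrow> real) \<Rightarrow> nat \<Rightarrow> nat" where
  "argmax_upto g 0 = 0"
| "argmax_upto g (Suc n) = (if g (argmax_upto g n) < g (Suc n) then Suc n else argmax_upto g n)"

lemma argmax_upto_le: "argmax_upto g n \<le> n"
  by (induction n) auto

lemma argmax_upto_ge: "k \<le> n \<Longrightarrow> g k \<le> g (argmax_upto g n)"
  by (induction n) (auto simp: le_Suc_eq)

text \<open>Each recursion step compares two real functions of \<open>x\<close>. The one with a
  varying index is measurable because that index is measurable and takes countably many
  values.\<close>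

lemma measurable_argmax_upto [measurable]:
  assumes [measurable]: "\<And>k. (\<lambda>x. g x k) \<in> borel_measurable M"
  shows "(\<lambda>x. argmax_upto (g x) n) \<in> M \<rightarrow>\<^sub>M count_space UNIV"
proof (induction n)
  case (Suc n)
  note [measurable] = Suc
  have [measurable]: "(\<lambda>x. g x (argmax_upto (g x) n)) \<in> borel_measurable M"
    by (rule measurable_compose_countable[OF _ Suc]) measurable
  show ?case
    by simp
qed simp

text \<open>The running maximum at \<open>n\<close> dominates \<open>g n\<close> and is itself a
  value of \<open>g\<close>. The map \<open>F\<close> carries the suprema into a complete lattice;
  with \<open>F = ereal\<close> they may be infinite.\<close>

lemma SUP_argmax_upto:
  fixes F :: "real \<Rightarrow> 'b::complete_lattice"
  assumes "mono F"
  shows "(SUP n. F (g (argmax_upto g n))) = (SUP n. F (g n))"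
proof (rule antisym)
  show "(SUP n. F (g (argmax_upto g n))) \<le> (SUP n. F (g n))"
    by (rule SUP_least) (rule SUP_upper, simp)
  show "(SUP n. F (g n)) \<le> (SUP n. F (g (argmax_upto g n)))"
    by (rule SUP_mono) (use argmax_upto_ge[OF order_refl] monoD[OF assms] in blast)
qed

section \<open>Pointwise conjugates and dense sequences\<close>

text \<open>By Cauchy-Schwarz, among all \<open>z\<close> of norm \<open>t\<close> the pairing with
  \<open>\<xi>\<close> is at most \<open>norm \<xi> * t\<close>, and \<open>t\<close> times a unit
  vector in the direction of \<open>\<xi>\<close> attains this.\<close>

lemma conj_vec_Phi_of: "conj_vec (Phi_of \<phi>) x \<xi> = conj_half \<phi> x (norm \<xi>)"
proof (rule antisym)
  show "conj_vec (Phi_of \<phi>) x \<xi> \<le> conj_half \<phi> x (norm \<xi>)"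
    unfolding conj_vec_def conj_half_def Phi_of_def
  proof (rule SUP_mono)
    fix z
    show "\<exists>t\<in>{0..}. ereal (\<xi> \<bullet> z - \<phi> x (norm z)) \<le> ereal (norm \<xi> * t - \<phi> x t)"
      by (rule bexI[of _ "norm z"]) (auto simp: norm_cauchy_schwarz)
  qed
  \<comment> \<open>For \<open>\<xi> = 0\<close> the value \<open>sgn \<xi>\<close> is zero, so an
    arbitrary coordinate vector serves as the unit vector.\<close>
  obtain e :: "real ^ 'b" where e: "norm e = 1" "\<xi> \<bullet> e = norm \<xi>"
  proof (cases "\<xi> = 0")
    case True
    then show ?thesis
      using that[of "axis undefined 1"] by simp
  next
    case False
    then show ?thesis
      using that[of "sgn \<xi>"]
      by (simp add: norm_sgn sgn_div_norm dot_square_norm power2_eq_square)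
  qed
  show "conj_half \<phi> x (norm \<xi>) \<le> conj_vec (Phi_of \<phi>) x \<xi>"
    unfolding conj_vec_def conj_half_def Phi_of_def
  proof (rule SUP_mono)
    fix t :: real
    assume "t \<in> {0..}"
    then show "\<exists>z\<in>UNIV. ereal (norm \<xi> * t - \<phi> x t) \<le> ereal (\<xi> \<bullet> z - \<phi> x (norm z))"
      using e by (intro bexI[of _ "t *\<^sub>R e"]) (auto simp: mult.commute)
  qed
qed

lemma conj_half_ge: "0 \<le> t \<Longrightarrow> ereal (s * t - \<phi> x t) \<le> conj_half \<phi> x s"
  unfolding conj_half_def by (rule SUP_upper) simp

text \<open>Every \<open>r \<ge> 0\<close> is a limit of points of the sequence, and continuity
  carries the bound to the limit. The countable supremum makes the conjugate integrand almost
  everywhere equal to a measurable function.\<close>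

lemma conj_half_eq_SUP_dense:
  assumes "continuous_on {0..} (\<phi> x)" and "\<And>k. 0 \<le> t k" and "{0..} \<subseteq> closure (range t)"
  shows "conj_half \<phi> x s = (SUP k::nat. ereal (s * t k - \<phi> x (t k)))"
proof (rule antisym)
  show "(SUP k. ereal (s * t k - \<phi> x (t k))) \<le> conj_half \<phi> x s"
    by (intro SUP_least conj_half_ge assms)
  show "conj_half \<phi> x s \<le> (SUP k. ereal (s * t k - \<phi> x (t k)))"
    unfolding conj_half_def
  proof (rule SUP_least)
    fix r :: real
    assume r: "r \<in> {0..}"
    with assms(3) have "r \<in> closure (range t)"
      by blast
    then obtain y where y: "\<forall>n. y n \<in> range t" "y \<longlonglongrightarrow> r"
      unfolding closure_sequential by auto
    have y0: "y n \<in> {0..}" for n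
      using y(1)[rule_format, of n] assms(2) by auto
    have "(\<lambda>n. \<phi> x (y n)) \<longlonglongrightarrow> \<phi> x r"
      using r y0
      by (intro continuous_on_tendsto_compose[OF assms(1) y(2)] always_eventually allI)
    then have "(\<lambda>n. ereal (s * y n - \<phi> x (y n))) \<longlonglongrightarrow> ereal (s * r - \<phi> x r)"
      by (intro tendsto_intros y(2))
    then show "ereal (s * r - \<phi> x r) \<le> (SUP k. ereal (s * t k - \<phi> x (t k)))"
    proof (rule LIMSEQ_le_const2, intro exI allI impI)
      fix n
      obtain k where k: "y n = t k"
        using y(1) by blast
      show "ereal (s * y n - \<phi> x (y n)) \<le> (SUP k. ereal (s * t k - \<phi> x (t k)))"
        unfolding k by (rule SUP_upper) simp
    qed
  qed
qed

text \<open>The normalisation \<open>t 0 = 0\<close> serves the lower bound: together with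
  \<open>\<phi> x 0 = 0\<close> it makes the running maxima nonnegative.\<close>

lemma dense_sequence_nonneg:
  obtains t :: "nat \<Rightarrow> real" where "t 0 = 0" "\<And>k. 0 \<le> t k" "{0..} \<subseteq> closure (range t)"
proof -
  obtain T :: "real set" where T: "countable T" "T \<subseteq> {0..}" "{0..} \<subseteq> closure T"
    using separable by blast
  then have "T \<noteq> {}"
    by auto
  then have ran: "range (from_nat_into T) = T"
    using T(1) by (rule range_from_nat_into)
  let ?t = "case_nat 0 (from_nat_into T)"
  have "T \<subseteq> range ?t"
    by (metis ran image_subset_iff nat.case(2) rangeI imageE)
  then have "{0..} \<subseteq> closure (range ?t)"
    using T(3) closure_mono by blast
  moreover have "0 \<le> ?t k" for k
    using T(2) ran by (cases k) auto
  ultimately show ?thesis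
    using that[of ?t] by simp
qed

section \<open>Integrated Young inequality and the upper bound\<close>

text \<open>In the upper bound \<open>h x\<close> is \<open>\<phi> x (norm (v x))\<close>, whose measurability would require a
  Caratheodory argument; the lemma is shaped to avoid it.\<close>

lemma nn_integral_le_add:
  assumes [measurable]: "f \<in> borel_measurable M" "g \<in> borel_measurable M"
    and "AE x in M. ennreal (f x) \<le> g x + h x"
  shows "(\<integral>\<^sup>+x. ennreal (f x) \<partial>M) \<le> integral\<^sup>N M g + integral\<^sup>N M h"
proof -
  \<comment> \<open>Additivity is applied to \<open>g\<close> and the truncated difference
    \<open>f - g\<close>, both measurable; \<open>h\<close> enters only through monotonicity of the
    integral.\<close>
  have "(\<integral>\<^sup>+x. ennreal (f x) \<partial>M) \<le> (\<integral>\<^sup>+x. g x + (ennreal (f x) - g x) \<partial>M)"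
    by (intro nn_integral_mono) (auto simp: add_diff_self_ennreal)
  also have "\<dots> = integral\<^sup>N M g + (\<integral>\<^sup>+x. ennreal (f x) - g x \<partial>M)"
    by (rule nn_integral_add) measurable
  also have "(\<integral>\<^sup>+x. ennreal (f x) - g x \<partial>M) \<le> integral\<^sup>N M h"
    by (rule nn_integral_mono_AE)
      (use assms(3) in eventually_elim, simp add: ennreal_minus_le_iff)
  finally show ?thesis
    by (simp add: add_left_mono)
qed

lemma ereal_integral_le_nn_integral: "ereal (integral\<^sup>L M f) \<le> enn2ereal (\<integral>\<^sup>+x. ennreal (f x) \<partial>M)"
proof (cases "integrable M f \<and> 0 \<le> integral\<^sup>L M f")
  case True
  have "ennreal (integral\<^sup>L M f) \<le> ennreal (\<integral>x. max 0 (f x) \<partial>M)"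
    using True by (intro ennreal_leI integral_mono) auto
  also have "\<dots> = (\<integral>\<^sup>+x. ennreal (f x) \<partial>M)"
    using True by (subst nn_integral_eq_integral[symmetric]) (auto simp: ennreal_max_0)
  finally show ?thesis
    using True by (simp add: less_eq_ennreal.rep_eq)
next
  case False
  \<comment> \<open>A nonintegrable \<open>f\<close> has integral \<open>0\<close> by
    default.\<close>
  then have "ereal (integral\<^sup>L M f) \<le> 0"
    using not_integrable_integral_eq by force
  then show ?thesis
    by (rule order_trans) simp
qed

text \<open>The free bound \<open>r\<close> allows two uses: \<open>r = p x \<bullet> v x\<close>
  through Cauchy-Schwarz, and \<open>r\<close> the norm of a multiple of \<open>p x\<close> with
  \<open>t = 1\<close>.\<close>

lemma conj_half_young_ennreal:
  assumes "0 \<le> t" "0 \<le> \<phi> x t" "r \<le> s * t"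
  shows "ennreal r \<le> ennreal (\<phi> x t) + e2ennreal (conj_half \<phi> x s)"
proof -
  have "ennreal r \<le> ennreal (\<phi> x t) + ennreal (s * t - \<phi> x t)"
    using assms by (auto simp: ennreal_plus_if intro!: ennreal_leI)
  also have "ennreal (s * t - \<phi> x t) \<le> e2ennreal (conj_half \<phi> x s)"
    using e2ennreal_mono[OF conj_half_ge[OF assms(1)], of s \<phi> x] by simp
  finally show ?thesis
    by (simp add: add_left_mono)
qed

lemma integral_minus_modular_le:
  assumes nonneg: "\<And>x t. x \<in> \<Omega> \<Longrightarrow> 0 \<le> t \<Longrightarrow> 0 \<le> \<phi> x t"
    and meas: "\<And>t. 0 \<le> t \<Longrightarrow> (\<lambda>x. \<phi> x t) \<in> borel_measurable (lebesgue_on \<Omega>)"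
    and cont: "AE x in lebesgue_on \<Omega>. continuous_on {0..} (\<phi> x)"
    and [measurable]: "p \<in> borel_measurable (lebesgue_on \<Omega>)" "v \<in> borel_measurable (lebesgue_on \<Omega>)"
  shows "ereal (\<integral>x. p x \<bullet> v x \<partial>lebesgue_on \<Omega>) - enn2ereal (modular \<Omega> (\<lambda>x t. ereal (\<phi> x t)) v)
    \<le> enn2ereal (modular \<Omega> (conj_half \<phi>) p)" (is "ereal ?I - enn2ereal ?B \<le> enn2ereal ?A")
proof -
  let ?M = "lebesgue_on \<Omega>"
  obtain t :: "nat \<Rightarrow> real" where t: "\<And>k. 0 \<le> t k" "{0..} \<subseteq> closure (range t)"
    using dense_sequence_nonneg by metis
  note [measurable] = meas[OF t(1)]
  \<comment> \<open>\<open>a\<close> is a measurable version of the conjugate integrand, as required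
    of the first summand in \<open>nn_integral_le_add\<close>.\<close>
  define a where "a x = e2ennreal (SUP k. ereal (norm (p x) * t k - \<phi> x (t k)))" for x
  have [measurable]: "a \<in> borel_measurable ?M"
    unfolding a_def by measurable
  have a: "AE x in ?M. a x = e2ennreal (conj_half \<phi> x (norm (p x)))"
    using cont by eventually_elim (simp add: a_def conj_half_eq_SUP_dense[OF _ t])
  have "(\<integral>\<^sup>+x. ennreal (p x \<bullet> v x) \<partial>?M) \<le> integral\<^sup>N ?M a + ?B"
    unfolding modular_def
  proof (rule nn_integral_le_add)
    show "AE x in ?M. ennreal (p x \<bullet> v x) \<le> a x + e2ennreal (ereal (\<phi> x (norm (v x))))"
      using a AE_space
    proof eventually_elim
      case (elim x)
      then show ?case
        using conj_half_young_ennreal[of "norm (v x)" \<phi> x "p x \<bullet> v x" "norm (p x)"] nonneg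
        by (simp add: norm_cauchy_schwarz add.commute space_restrict_space)
    qed
  qed measurable
  also have "integral\<^sup>N ?M a = ?A"
    unfolding modular_def by (rule nn_integral_cong_AE) (fact a)
  finally have "ereal ?I \<le> enn2ereal (?A + ?B)"
    using order_trans[OF ereal_integral_le_nn_integral] by (simp add: less_eq_ennreal.rep_eq)
  then show ?thesis
    \<comment> \<open>\<open>?I\<close> is real, so an infinite \<open>?B\<close> makes the
      left-hand side minus infinity.\<close>
    by (cases "enn2ereal ?B"; cases "enn2ereal ?A")
      (auto simp: plus_ennreal.rep_eq)
qed

section \<open>Integrability of \<open>p\<close> and the lower bound\<close>

text \<open>Young's inequality at \<open>t = 1\<close> bounds the norm of a positive multiple of
  \<open>p\<close> by \<open>\<phi> x 1\<close> plus a conjugate term of finite integral. Hence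
  \<open>p\<close> pairs integrably with the bounded competitors of the lower bound.\<close>

lemma L_space_conj_half_integrable:
  assumes nonneg: "\<And>x. x \<in> \<Omega> \<Longrightarrow> 0 \<le> \<phi> x 1"
    and int: "integrable (lebesgue_on \<Omega>) (\<lambda>x. \<phi> x 1)"
    and p: "p \<in> L_space \<Omega> (conj_half \<phi>)"
  shows "integrable (lebesgue_on \<Omega>) p"
proof -
  let ?M = "lebesgue_on \<Omega>"
  obtain c :: real where c: "0 < c" "modular \<Omega> (conj_half \<phi>) (\<lambda>x. c *\<^sub>R p x) < \<infinity>"
    and [measurable]: "p \<in> borel_measurable ?M"
    using p by (auto simp: L_space_def)
  have [measurable]: "(\<lambda>x. \<phi> x 1) \<in> borel_measurable ?M"
    using int by auto
  have "(\<integral>\<^sup>+x. ennreal (norm (c *\<^sub>R p x)) \<partial>?M)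
      \<le> (\<integral>\<^sup>+x. ennreal (\<phi> x 1) \<partial>?M) + modular \<Omega> (conj_half \<phi>) (\<lambda>x. c *\<^sub>R p x)"
    unfolding modular_def
    by (intro nn_integral_le_add AE_I2 conj_half_young_ennreal)
      (auto simp: space_restrict_space nonneg)
  also have "\<dots> < \<infinity>"
    using c(2) integrableD(2)[OF int] nonneg
    by (subst nn_integral_eq_integral[OF int]) (auto simp: space_restrict_space intro!: AE_I2)
  finally have "integrable ?M (\<lambda>x. c *\<^sub>R p x)"
    by (intro integrableI_bounded) auto
  then show ?thesis
    using integrable_scaleR_right[of "1 / c" ?M "\<lambda>x. c *\<^sub>R p x"] c(1) by simp
qed

lemma modular_conj_half_le_conj_modular:
  assumes nonneg: "\<And>x t. x \<in> \<Omega> \<Longrightarrow> 0 \<le> t \<Longrightarrow> 0 \<le> \<phi> x t"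
    and cont: "AE x in lebesgue_on \<Omega>. continuous_on {0..} (\<phi> x) \<and> \<phi> x 0 = 0"
    and int: "\<And>t. 0 \<le> t \<Longrightarrow> integrable (lebesgue_on \<Omega>) (\<lambda>x. \<phi> x t)"
    and p: "integrable (lebesgue_on \<Omega>) p"
  shows "enn2ereal (modular \<Omega> (conj_half \<phi>) p) \<le> conj_modular \<Omega> \<phi> p"
proof -
  let ?M = "lebesgue_on \<Omega>"
  have [measurable]: "p \<in> borel_measurable ?M"
    using p by auto
  obtain t :: "nat \<Rightarrow> real" where t: "t 0 = 0" "\<And>k. 0 \<le> t k" "{0..} \<subseteq> closure (range t)"
    using dense_sequence_nonneg by blast
  have [measurable]: "(\<lambda>x. \<phi> x (t k)) \<in> borel_measurable ?M" for k
    using int[OF t(2)] by auto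
  define g where "g x k = norm (p x) * t k - \<phi> x (t k)" for x k
  have [measurable]: "(\<lambda>x. g x k) \<in> borel_measurable ?M" for k
    unfolding g_def by measurable
  define T where "T n x = t (argmax_upto (g x) n)" for n x
  have [measurable]: "T n \<in> borel_measurable ?M" for n
    unfolding T_def by measurable
  \<comment> \<open>\<open>T n\<close> only takes values of the sequence \<open>t\<close>, so
    measurability of each \<open>\<phi> x (t k)\<close> in \<open>x\<close> suffices.\<close>
  have [measurable]: "(\<lambda>x. \<phi> x (T n x)) \<in> borel_measurable ?M" for n
    unfolding T_def
    by (rule measurable_compose_countable[where g = "\<lambda>x. argmax_upto (g x) n"]) measurable
  have T0: "0 \<le> T n x" for n x
    by (simp add: T_def t)
  define G where "G n x = g x (argmax_upto (g x) n)" for n x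
  have G: "G n x = norm (p x) * T n x - \<phi> x (T n x)" for n x
    by (simp add: G_def g_def T_def)
  have [measurable]: "G n \<in> borel_measurable ?M" for n
    unfolding G by measurable
  have inc: "incseq (\<lambda>n. G n x)" for x
    by (rule incseq_SucI) (simp add: G_def)
  have G0: "AE x in ?M. 0 \<le> G n x" for n
    using cont
  proof eventually_elim
    case (elim x)
    then show ?case
      using argmax_upto_ge[of 0 n "g x"] by (simp add: G_def g_def t)
  qed
  define v where "v n x = T n x *\<^sub>R sgn (p x)" for n x
  have [measurable]: "v n \<in> borel_measurable ?M" for n
    unfolding v_def sgn_div_norm by measurable
  have pv: "p x \<bullet> v n x = norm (p x) * T n x" for n x
    by (simp add: v_def sgn_div_norm dot_square_norm power2_eq_square field_simps)
  \<comment> \<open>Where \<open>p x = 0\<close> the field \<open>v n\<close> vanishes even if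
    \<open>T n x\<close> does not. There \<open>G n x = - \<phi> x (T n x)\<close> is nonnegative,
    so \<open>\<phi> x (T n x) = 0 = \<phi> x 0\<close> and the values still agree.\<close>
  have \<phi>v: "AE x in ?M. \<phi> x (norm (v n x)) = \<phi> x (T n x)" for n
    using cont G0[of n] AE_space
  proof eventually_elim
    case (elim x)
    show ?case
    proof (cases "p x = 0")
      case True
      then have "\<phi> x (T n x) = 0"
        using elim G[of n x] nonneg[OF _ T0, of x n x] by (simp add: space_restrict_space)
      then show ?thesis
        using elim True by (simp add: v_def)
    qed (simp add: v_def norm_sgn T0)
  qed
  have intT: "integrable ?M (\<lambda>x. \<phi> x (T n x))" for n
  proof (rule Bochner_Integration.integrable_bound)
    show "integrable ?M (\<lambda>x. \<Sum>k\<le>n. \<phi> x (t k))"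
      by (intro Bochner_Integration.integrable_sum int t)
    show "AE x in ?M. norm (\<phi> x (T n x)) \<le> norm (\<Sum>k\<le>n. \<phi> x (t k))"
    proof (rule AE_I2)
      fix x
      assume "x \<in> space ?M"
      then have "0 \<le> \<phi> x (t k)" for k
        using nonneg t(2) by (simp add: space_restrict_space)
      then show "norm (\<phi> x (T n x)) \<le> norm (\<Sum>k\<le>n. \<phi> x (t k))"
        using member_le_sum[where f = "\<lambda>k. \<phi> x (t k)" and A = "{..n}" and i = "argmax_upto (g x) n"]
        by (simp add: T_def sum_nonneg argmax_upto_le)
    qed
  qed measurable
  have intpT: "integrable ?M (\<lambda>x. norm (p x) * T n x)" for n
  proof (rule Bochner_Integration.integrable_bound)
    show "integrable ?M (\<lambda>x. norm (p x) * (\<Sum>k\<le>n. t k))"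
      using p by simp
    have "T n x \<le> (\<Sum>k\<le>n. t k)" for x
      using member_le_sum[where f = t and A = "{..n}" and i = "argmax_upto (g x) n"]
      by (simp add: T_def argmax_upto_le t)
    then show "AE x in ?M. norm (norm (p x) * T n x) \<le> norm (norm (p x) * (\<Sum>k\<le>n. t k))"
      using T0 by (intro AE_I2) (simp add: abs_mult mult_left_mono sum_nonneg t)
  qed measurable
  have le: "(\<integral>\<^sup>+x. ennreal (G n x) \<partial>?M) \<le> e2ennreal (conj_modular \<Omega> \<phi> p)" for n
  proof -
    have "AE x in ?M. 0 \<le> \<phi> x (T n x)"
      using nonneg T0 by (intro AE_I2) (simp add: space_restrict_space)
    moreover have "modular \<Omega> (\<lambda>x t. ereal (\<phi> x t)) (v n) = (\<integral>\<^sup>+x. ennreal (\<phi> x (T n x)) \<partial>?M)"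
      unfolding modular_def by (rule nn_integral_cong_AE) (use \<phi>v[of n] in eventually_elim, simp)
    ultimately have mod: "modular \<Omega> (\<lambda>x t. ereal (\<phi> x t)) (v n) = ennreal (\<integral>x. \<phi> x (T n x) \<partial>?M)"
      and mod0: "0 \<le> (\<integral>x. \<phi> x (T n x) \<partial>?M)"
      using intT[of n] by (simp_all add: nn_integral_eq_integral integral_nonneg_AE)
    have "v n \<in> L_space \<Omega> (\<lambda>x t. ereal (\<phi> x t))"
      unfolding L_space_def using mod by (auto intro!: exI[of _ 1])
    then have "ereal (\<integral>x. p x \<bullet> v n x \<partial>?M) - enn2ereal (modular \<Omega> (\<lambda>x t. ereal (\<phi> x t)) (v n))
        \<le> conj_modular \<Omega> \<phi> p"
      unfolding conj_modular_def by (rule SUP_upper)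
    \<comment> \<open>The modular of \<open>v n\<close> is finite, so the extended difference is a
      real one and linearity merges the two integrals.\<close>
    then have "ereal (integral\<^sup>L ?M (G n)) \<le> conj_modular \<Omega> \<phi> p"
      using mod0 intT[of n] intpT[of n] unfolding mod pv G by simp
    moreover have "(\<integral>\<^sup>+x. ennreal (G n x) \<partial>?M) = ennreal (integral\<^sup>L ?M (G n))"
      using G0 intT intpT unfolding G by (intro nn_integral_eq_integral) auto
    ultimately show ?thesis
      using e2ennreal_mono by fastforce
  qed
  have "modular \<Omega> (conj_half \<phi>) p = (\<integral>\<^sup>+x. (SUP n. ennreal (G n x)) \<partial>?M)"
    unfolding modular_def
  proof (rule nn_integral_cong_AE, use cont in eventually_elim)
    case (elim x)
    then have "conj_half \<phi> x (norm (p x)) = (SUP n. ereal (G n x))"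
      unfolding G_def SUP_argmax_upto[OF monoI[of ereal], simplified]
      by (simp add: g_def conj_half_eq_SUP_dense[OF _ t(2,3)])
    then show ?case
      \<comment> \<open>\<open>e2ennreal\<close> commutes with suprema of increasing
        sequences.\<close>
      using sup_continuousD[OF sup_continuous_e2ennreal[OF sup_continuous_id], of "\<lambda>n. ereal (G n x)"] inc
      by (simp add: incseq_def)
  qed
  also have "\<dots> = (SUP n. \<integral>\<^sup>+x. ennreal (G n x) \<partial>?M)"
    using inc by (intro nn_integral_monotone_convergence_SUP)
      (auto simp: incseq_def le_fun_def intro!: ennreal_leI)
  also have "\<dots> \<le> e2ennreal (conj_modular \<Omega> \<phi> p)"
    by (intro SUP_least le)
  finally have le': "modular \<Omega> (conj_half \<phi>) p \<le> e2ennreal (conj_modular \<Omega> \<phi> p)" .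
  \<comment> \<open>The zero field shows that the supremum is nonnegative, so truncating it by
    \<open>e2ennreal\<close> loses nothing.\<close>
  have "modular \<Omega> (\<lambda>x t. ereal (\<phi> x t)) (\<lambda>x. 0) = (\<integral>\<^sup>+x. 0 \<partial>?M)"
    unfolding modular_def by (rule nn_integral_cong_AE) (use cont in eventually_elim, simp)
  then have "0 \<le> conj_modular \<Omega> \<phi> p"
    unfolding conj_modular_def L_space_def
    by (intro SUP_upper2[of "\<lambda>x. 0"])
      (auto simp: zero_ennreal.rep_eq zero_ereal_def[symmetric] intro!: exI[of _ 1])
  with le' show ?thesis
    by (simp add: less_eq_ennreal.rep_eq enn2ereal_e2ennreal)
qed

theorem proposition3p7:
  fixes \<Omega> :: "(real ^ 'n) set"
    and \<phi> :: "real ^ 'n \<Rightarrow> real \<Rightarrow> real"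
    and p :: "real ^ 'n \<Rightarrow> real ^ 'n"
  assumes "bounded \<Omega>" and "lipschitz_domain \<Omega>"
    and "\<And>x t. x \<in> \<Omega> \<Longrightarrow> 0 \<le> t \<Longrightarrow> 0 \<le> \<phi> x t"
    and "\<And>t. 0 \<le> t \<Longrightarrow> (\<lambda>x. \<phi> x t) \<in> borel_measurable (lebesgue_on \<Omega>)"
    and "AE x in lebesgue_on \<Omega>. convex_on {0..} (\<phi> x) \<and> mono_on {0..} (\<phi> x) \<and>
           continuous_on {0..} (\<phi> x) \<and> \<phi> x 0 = 0"
    and "\<And>t. 0 \<le> t \<Longrightarrow> integrable (lebesgue_on \<Omega>) (\<lambda>x. \<phi> x t)"
    and "\<exists>C. AE x in lebesgue_on \<Omega>. \<forall>t\<ge>0. \<phi> x (2 * t) \<le> C * \<phi> x t"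
    and "((\<lambda>t. essinf (lebesgue_on \<Omega>) (\<lambda>x. ereal (\<phi> x t / t))) \<longlongrightarrow> \<infinity>) at_top"
    and "p \<in> L_space \<Omega> (conj_half \<phi>)"
  shows "conj_modular \<Omega> \<phi> p =
           enn2ereal (\<integral>\<^sup>+ x. e2ennreal (conj_vec (Phi_of \<phi>) x (p x)) \<partial>lebesgue_on \<Omega>) \<and>
         (\<integral>\<^sup>+ x. e2ennreal (conj_vec (Phi_of \<phi>) x (p x)) \<partial>lebesgue_on \<Omega>) =
           (\<integral>\<^sup>+ x. e2ennreal (conj_half \<phi> x (norm (p x))) \<partial>lebesgue_on \<Omega>) \<and>
         (conj_modular \<Omega> \<phi> p < \<infinity> \<longleftrightarrow> p \<in> dom_modular \<Omega> (conj_half \<phi>))"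
proof -
  have cont: "AE x in lebesgue_on \<Omega>. continuous_on {0..} (\<phi> x) \<and> \<phi> x 0 = 0"
    using assms(5) by eventually_elim blast
  have "integrable (lebesgue_on \<Omega>) p"
    using assms(3,6,9) by (intro L_space_conj_half_integrable) auto
  then have "enn2ereal (modular \<Omega> (conj_half \<phi>) p) \<le> conj_modular \<Omega> \<phi> p"
    using assms(3,6) cont by (intro modular_conj_half_le_conj_modular)
  moreover have "conj_modular \<Omega> \<phi> p \<le> enn2ereal (modular \<Omega> (conj_half \<phi>) p)"
    unfolding conj_modular_def
    using assms(3,4,9) cont
    by (intro SUP_least integral_minus_modular_le) (auto simp: L_space_def elim: eventually_mono)
  ultimately have "conj_modular \<Omega> \<phi> p = enn2ereal (modular \<Omega> (conj_half \<phi>) p)"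
    by (rule antisym[rotated])
  moreover have "enn2ereal a < \<infinity> \<longleftrightarrow> a < \<infinity>" for a
    by (cases a) auto
  \<comment> \<open>The two integrands agree pointwise by \<open>conj_vec_Phi_of\<close>; as
    \<open>p\<close> lies in the space, membership in \<open>dom_modular\<close> amounts to a finite
    modular.\<close>
  ultimately show ?thesis
    using assms(9) by (simp add: conj_vec_Phi_of dom_modular_def modular_def)
qed

end
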